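(* Let $n<24$ and let $C$ be a binary self-dual code of length $n$ with no codewords of weight $2$. Let $d$ be defined by the condition that $C$ has exactly $n(22-n)/8+d$ codewords of weight $4$. Then $d$ is a nonnegative integer multiple of $2^{(24-n)/2}$.
   Context: Let $F=\mathbb{Z}/2\mathbb{Z}$. The (Hamming) weight of $w\in F^n$ is the number of nonzero coordinates of $w$. A binary self-dual code of length $n$ is a linear subspace $C\subset F^n$ which equals its own annihilator under the pairing $(v,w)=\sum_{j=1}^n v_jw_j\in F$; such a code exists only if $n$ is even. *)

theory Defs
  imports "HOL-Library.Z2" "Jordan_Normal_Form.VS_Connect"
begin

definition hamming_weight :: "'a::zero vec \<Rightarrow> nat" where
  "hamming_weight w = card {i. i < dim_vec w \<and> w $ i \<noteq> 0}"

text \<open>The annihilator is taken inside the ambient space \<^term>\<open>carrier_vec n\<close> with respect to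
  \<^const>\<open>scalar_prod\<close>, whose values lie in the two-element field \<^typ>\<open>bit\<close>.\<close>

definition annihilator :: "nat \<Rightarrow> bit vec set \<Rightarrow> bit vec set" where
  "annihilator n C = {v \<in> carrier_vec n. \<forall>w\<in>C. v \<bullet> w = 0}"

definition self_dual_code :: "nat \<Rightarrow> bit vec set \<Rightarrow> bool" where
  "self_dual_code n C \<longleftrightarrow>
     VectorSpace.subspace class_ring C (module_vec TYPE(bit) n) \<and> C = annihilator n C"

end

theory Submission
  imports Defs
begin

text \<open>
  The proof reads the weight distribution of \<open>C\<close> off that of its \<^emph>\<open>shadow\<close>: the set \<open>S\<close> of words
  \<open>s\<close> with \<open>(s, c) = wt(c)/2\<close> mod 2 for every codeword \<open>c\<close>. Halved weight mod 2 is additive on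
  \<open>C\<close>, because two codewords overlap in an even number of places, so \<open>c \<mapsto> (-1)^(wt(c)/2)\<close> is a
  character of \<open>C\<close>. Detecting membership in \<open>S\<close> by a character sum over \<open>C\<close> and summing over all
  binary words first gives a MacWilliams identity (\<open>shadow_transform\<close>), valid in every integral
  domain of characteristic zero:
  \<open>\<Sum>s\<in>S. (1 - y)^wt(s) (1 + y)^(n - wt(s)) = |C| \<Sum>c\<in>C. (-1)^(wt(c)/2) y^wt(c)\<close>.
  It is used at three values of \<open>y\<close>.

  \<^item> At \<open>y = 0\<close> it says that \<open>|S| = |C|\<close>, where \<open>|C| = 2^(n/2)\<close>.

  \<^item> At \<open>y = \<i>\<close> all terms on the right are 1, while the \<open>|C|\<close> terms on the left have modulus
    \<open>|C|\<close>; so equality holds in the triangle inequality, and this forces \<open>wt(s) = n/2\<close> mod 4 on \<open>S\<close>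
    (\<open>card_shadow_mem_cong\<close>). Hence \<open>u = n - 2 wt(s)\<close> is a multiple of 8, and
    for \<open>n < 24\<close> it lies in \<open>{0, 8, -8, 16, -16}\<close>.

  \<^item> With \<open>y\<close> an indeterminate, the coefficients of degree 2 and 4 give \<open>\<Sum>u\<^sup>2\<close> and \<open>\<Sum>u^4\<close> over
    \<open>S\<close> in terms of the number of words of weight 4, as there are none of weight 2
    (\<open>shadow_moments\<close>).

  The combination \<open>u\<^sup>2 (u\<^sup>2 - 64)\<close> vanishes unless \<open>u = 16\<close> or \<open>u = -16\<close>, where it is
  \<open>256 * 192\<close>; its sum over \<open>S\<close> is \<open>24 d |C|\<close>. The shadow is closed under complementation, so
  both signs occur equally often, say \<open>N\<close> times. Therefore
  \<open>24 d * 2^(n/2) = 2 * 256 * 192 * N\<close>, that is \<open>d = 2^((24 - n)/2) N\<close>.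

  Words are replaced throughout by their supports, so that the scalar product of two words becomes
  the parity of the size of an intersection and addition becomes symmetric difference.
\<close>

section \<open>Low coefficients of a product of binomial powers\<close>

text \<open>
  These are the Krawtchouk polynomials of degree 2 and 4, centred at the middle weight. Multiplying
  by \<open>1 + e X\<close> with \<open>e = 1\<close> or \<open>e = -1\<close> changes \<open>u\<close> by \<open>e\<close> and \<open>n\<close> by 1, and the formulas follow
  by induction once those for degrees 0, 1 and 3 are carried along.
\<close>

lemma krawtchouk_coeffs:
  fixes a b :: nat
  defines "p \<equiv> (1 - [:0, 1:]) ^ a * (1 + [:0, 1:]) ^ b :: real poly"
    and "u \<equiv> real b - real a" and "n \<equiv> real a + real b"
  shows "2 * poly.coeff p 2 = u\<^sup>2 - n"
    and "24 * poly.coeff p 4 = u ^ 4 - (6 * n - 8) * u\<^sup>2 + 3 * n\<^sup>2 - 6 * n"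
proof -
  define Q :: "real poly \<Rightarrow> real \<Rightarrow> real \<Rightarrow> bool" where
    "Q = (\<lambda>p u n. poly.coeff p 0 = 1 \<and> poly.coeff p 1 = u \<and> 2 * poly.coeff p 2 = u\<^sup>2 - n
        \<and> 6 * poly.coeff p 3 = u ^ 3 - (3 * n - 2) * u
        \<and> 24 * poly.coeff p 4 = u ^ 4 - (6 * n - 8) * u\<^sup>2 + 3 * n\<^sup>2 - 6 * n)"
  have step: "Q ((1 + [:0, e:]) * p) (u + e) (n + 1)"
    if "Q p u n" and e: "e = 1 \<or> e = -1" for p u n e
  proof -
    have c: "poly.coeff ((1 + [:0, e:]) * p) (Suc k)
        = poly.coeff p (Suc k) + e * poly.coeff p k" for k
      by (simp add: algebra_simps)
    have c0: "poly.coeff ((1 + [:0, e:]) * p) 0 = poly.coeff p 0"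
      by (simp add: algebra_simps)
    show ?thesis
      using that c[of 0] c[of 1] c[of 2] c[of 3] c0 unfolding Q_def
      by (auto simp: numeral_eq_Suc algebra_simps)
  qed
  have base: "Q (1 :: real poly) 0 0"
    by (simp add: Q_def numeral_eq_Suc)
  have "Q ((1 - [:0, 1:]) ^ a) (- real a) (real a)"
  proof (induction a)
    case 0
    then show ?case using base by simp
  next
    case (Suc a)
    have "1 + [:0, -1:] = (1 - [:0, 1:] :: real poly)" by (simp add: one_pCons)
    then have "Q ((1 - [:0, 1:]) ^ Suc a) (- real a + - 1) (real a + 1)"
      using step[OF Suc, of "-1"] by (simp only: power_Suc) simp
    then show ?case by (simp only: of_nat_Suc minus_add add.commute)
  qed
  then have "Q ((1 - [:0, 1:]) ^ a * (1 + [:0, 1:]) ^ b) (real b - real a) (real a + real b)"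
  proof (induction b)
    case 0
    then show ?case by simp
  next
    case (Suc b)
    have "Q ((1 - [:0, 1:]) ^ a * (1 + [:0, 1:]) ^ Suc b)
        (real b - real a + 1) (real a + real b + 1)"
      using step[OF Suc.IH[OF Suc.prems], of 1] by (simp only: power_Suc mult_ac) simp
    moreover have "real b - real a + 1 = real (Suc b) - real a"
      "real a + real b + 1 = real a + real (Suc b)" by simp_all
    ultimately show ?case by (simp only:)
  qed
  then have "Q p u n"
    by (simp add: p_def u_def n_def)
  then show "2 * poly.coeff p 2 = u\<^sup>2 - n"
    "24 * poly.coeff p 4 = u ^ 4 - (6 * n - 8) * u\<^sup>2 + 3 * n\<^sup>2 - 6 * n"
    by (auto simp: Q_def)
qed

section \<open>Self-dual families of sets\<close>

lemma card_sym_diff_Int: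
  assumes "finite A" "finite B"
  shows "card (sym_diff A B) + 2 * card (A \<inter> B) = card A + card B"
proof -
  have "card (sym_diff A B) = card (A - B) + card (B - A)"
    by (rule card_Un_disjoint) (use assms in auto)
  moreover have "card A = card (A - B) + card (A \<inter> B)"
    using card_Diff_subset_Int[of A B] assms card_mono[of A "A \<inter> B"] by simp
  moreover have "card B = card (B - A) + card (A \<inter> B)"
    using card_Diff_subset_Int[of B A] assms card_mono[of B "B \<inter> A"] by (simp add: Int_commute)
  ultimately show ?thesis by simp
qed

text \<open>
  The sum factors over the points of \<open>I\<close>: a point contributes \<open>(1 + y) + (1 - y) = 2\<close> outside \<open>c\<close>
  and \<open>(1 + y) - (1 - y) = 2 y\<close> inside.
\<close>

lemma signed_power_sum_Pow:
  fixes y :: "'a :: comm_ring_1"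
  assumes "finite I" "c \<subseteq> I"
  shows "(\<Sum>s\<in>Pow I. (-1) ^ card (c \<inter> s) * ((1 - y) ^ card s * (1 + y) ^ (card I - card s)))
       = 2 ^ card I * y ^ card c"
proof -
  have "(\<Sum>s\<in>Pow I. (-1) ^ card (c \<inter> s) * ((1 - y) ^ card s * (1 + y) ^ (card I - card s)))
      = (\<Sum>s\<in>Pow I. (\<Prod>j\<in>s. (if j \<in> c then -1 else 1) * (1 - y)) * (\<Prod>j\<in>I - s. 1 + y))"
  proof (rule sum.cong[OF refl])
    fix s assume s: "s \<in> Pow I"
    then have fin: "finite s" using assms finite_subset by blast
    have "(\<Prod>j\<in>s. if j \<in> c then -1 else 1 :: 'a) = (-1) ^ card (c \<inter> s)"
      using fin by (simp add: prod.If_cases Int_commute)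
    then show "(-1) ^ card (c \<inter> s) * ((1 - y) ^ card s * (1 + y) ^ (card I - card s))
      = (\<Prod>j\<in>s. (if j \<in> c then -1 else 1) * (1 - y)) * (\<Prod>j\<in>I - s. 1 + y)"
      using s fin by (simp add: prod.distrib card_Diff_subset mult_ac)
  qed
  also have "\<dots> = (\<Prod>j\<in>I. (if j \<in> c then -1 else 1) * (1 - y) + (1 + y))"
    using assms by (subst prod_add) auto
  also have "\<dots> = (\<Prod>j\<in>I. 2 * (if j \<in> c then y else 1))"
    by (rule prod.cong) auto
  also have "\<dots> = 2 ^ card I * y ^ card c"
    using assms by (simp add: prod.distrib prod.If_cases Int_absorb1)
  finally show ?thesis .
qed

text \<open>
  Supports of the words of a binary self-dual code. The single condition \<open>mem_iff\<close> also encodes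
  linearity, since an annihilator is closed under symmetric difference.
\<close>

locale self_dual_family =
  fixes I :: "'i set" and C :: "'i set set"
  assumes finite_I: "finite I"
    and mem_iff: "c \<in> C \<longleftrightarrow> c \<subseteq> I \<and> (\<forall>d\<in>C. even (card (c \<inter> d)))"
begin

lemma subset_I: "c \<in> C \<Longrightarrow> c \<subseteq> I"
  using mem_iff by blast

lemma finite_mem: "c \<in> C \<Longrightarrow> finite c"
  using subset_I finite_I finite_subset by blast

lemma finite_C: "finite C"
  by (rule finite_subset[of _ "Pow I"]) (use subset_I finite_I in auto)

lemma even_Int: "c \<in> C \<Longrightarrow> d \<in> C \<Longrightarrow> even (card (c \<inter> d))"
  using mem_iff by blast

lemma even_card: "c \<in> C \<Longrightarrow> even (card c)"
  using even_Int[of c c] by simp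

lemma empty_mem: "{} \<in> C"
  by (subst mem_iff) simp

text \<open>The all-one word is orthogonal to \<open>d\<close> because \<open>d\<close> is orthogonal to itself.\<close>

lemma I_mem: "I \<in> C"
  by (subst mem_iff) (use even_card subset_I in \<open>auto simp: Int_absorb1\<close>)

lemma even_card_Int_sym_diff:
  assumes "finite s" "finite a" "finite b"
  shows "even (card (sym_diff a b \<inter> s)) \<longleftrightarrow> even (card (a \<inter> s) + card (b \<inter> s))"
proof -
  have "sym_diff a b \<inter> s = sym_diff (a \<inter> s) (b \<inter> s)" by auto
  with card_sym_diff_Int[of "a \<inter> s" "b \<inter> s"] assms show ?thesis
    by (metis even_add finite_Int dvd_triv_left)
qed

lemma sym_diff_mem:
  assumes "a \<in> C" "b \<in> C"
  shows "sym_diff a b \<in> C"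
proof (subst mem_iff, intro conjI ballI)
  show "sym_diff a b \<subseteq> I" using assms subset_I by blast
  fix d assume "d \<in> C"
  then show "even (card (sym_diff a b \<inter> d))"
    using assms even_Int finite_mem by (subst even_card_Int_sym_diff) auto
qed

text \<open>Translating by a codeword \<open>a\<close> permutes \<open>C\<close> and multiplies the sum by \<open>\<chi> a\<close>.\<close>

lemma character_sum:
  fixes \<chi> :: "'i set \<Rightarrow> int"
  assumes mult: "\<And>a b. a \<in> C \<Longrightarrow> b \<in> C \<Longrightarrow> \<chi> (sym_diff a b) = \<chi> a * \<chi> b"
  shows "sum \<chi> C = (if \<forall>c\<in>C. \<chi> c = 1 then int (card C) else 0)"
proof (cases "\<forall>c\<in>C. \<chi> c = 1")
  case True
  then show ?thesis by simp
next
  case False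
  then obtain a where a: "a \<in> C" "\<chi> a \<noteq> 1" by blast
  have "sum \<chi> C = (\<Sum>c\<in>C. \<chi> (sym_diff a c))"
    by (rule sum.reindex_bij_witness[of _ "sym_diff a" "sym_diff a"])
       (use a sym_diff_mem in \<open>auto intro: arg_cong[of _ _ \<chi>]\<close>)
  also have "\<dots> = \<chi> a * sum \<chi> C"
    using a by (simp add: mult sum_distrib_left)
  finally show ?thesis using a False by auto
qed

lemma sign_sym_diff:
  assumes "finite s" "a \<in> C" "b \<in> C"
  shows "(-1 :: int) ^ card (sym_diff a b \<inter> s) = (-1) ^ card (a \<inter> s) * (-1) ^ card (b \<inter> s)"
  using even_card_Int_sym_diff[of s a b] assms finite_mem
  by (simp add: minus_one_power_iff)

definition phase :: "'i set \<Rightarrow> int" where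
  "phase c = (-1) ^ (card c div 2)"

text \<open>
  Additivity of the halved weight mod 2: the overlap of two codewords is subtracted twice from the
  sum of their weights, and it is even.
\<close>

lemma phase_sym_diff:
  assumes "a \<in> C" "b \<in> C"
  shows "phase (sym_diff a b) = phase a * phase b"
proof -
  obtain i j k where ijk: "card a = 2 * i" "card b = 2 * j" "card (a \<inter> b) = 2 * k"
    using even_card even_Int assms by (meson evenE)
  then have "card (sym_diff a b) + 4 * k = 2 * i + 2 * j"
    using card_sym_diff_Int[of a b] assms finite_mem by simp
  then have "card (sym_diff a b) div 2 + 2 * k = i + j" by presburger
  then have "even (card (sym_diff a b) div 2) \<longleftrightarrow> even (i + j)" by presburger
  then show ?thesis by (simp add: phase_def ijk minus_one_power_iff)
qed

text \<open>
  This is the shadow of Conway and Sloane: \<open>C\<close> itself if \<open>C\<close> is doubly even, and otherwise the part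
  outside \<open>C\<close> of the dual of the doubly even subcode.
\<close>

definition shadow :: "'i set set" where
  "shadow = {s \<in> Pow I. \<forall>c\<in>C. (-1) ^ card (c \<inter> s) = phase c}"

lemma shadow_subset: "s \<in> shadow \<Longrightarrow> s \<subseteq> I"
  by (simp add: shadow_def)

lemma finite_shadow: "finite shadow"
  using finite_I by (simp add: shadow_def)

lemma phase_square: "phase c * phase c = 1"
  by (simp add: phase_def flip: power_mult_distrib)

lemma phase_character_sum:
  assumes "s \<subseteq> I"
  shows "(\<Sum>c\<in>C. phase c * (-1) ^ card (c \<inter> s)) = (if s \<in> shadow then int (card C) else 0)"
proof -
  have fin: "finite s" using assms finite_I finite_subset by blast
  have "(phase c * (-1) ^ card (c \<inter> s) = 1) = ((-1) ^ card (c \<inter> s) = phase c)" for c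
    by (auto simp: phase_def minus_one_power_iff)
  then show ?thesis
    using assms fin
    by (subst character_sum) (auto simp: phase_sym_diff sign_sym_diff shadow_def)
qed

text \<open>
  The left side is a sum over all words weighted by the character sum that detects the shadow;
  interchanging the two sums leaves a sum over all words for each codeword.
\<close>

lemma shadow_transform_scaled:
  fixes y :: "'a :: comm_ring_1"
  shows "of_nat (card C) * (\<Sum>s\<in>shadow. (1 - y) ^ card s * (1 + y) ^ (card I - card s))
       = 2 ^ card I * (\<Sum>c\<in>C. of_int (phase c) * y ^ card c)"
proof -
  let ?g = "\<lambda>s. (1 - y) ^ card s * (1 + y) ^ (card I - card s)"
  have "of_nat (card C) * sum ?g shadow
      = (\<Sum>s\<in>Pow I. of_int (\<Sum>c\<in>C. phase c * (-1) ^ card (c \<inter> s)) * ?g s)"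
    unfolding sum_distrib_left using finite_I shadow_subset
    by (intro sum.mono_neutral_cong_left) (auto simp: phase_character_sum)
  also have "\<dots> = (\<Sum>s\<in>Pow I. \<Sum>c\<in>C. of_int (phase c) * ((-1) ^ card (c \<inter> s) * ?g s))"
    by (simp add: sum_distrib_right mult.assoc)
  also have "\<dots> = (\<Sum>c\<in>C. of_int (phase c) * (\<Sum>s\<in>Pow I. (-1) ^ card (c \<inter> s) * ?g s))"
    by (subst sum.swap) (simp add: sum_distrib_left)
  also have "\<dots> = (\<Sum>c\<in>C. of_int (phase c) * (2 ^ card I * y ^ card c))"
    by (intro sum.cong refl arg_cong2[of _ _ _ _ "(*)"] signed_power_sum_Pow finite_I subset_I)
  also have "\<dots> = 2 ^ card I * (\<Sum>c\<in>C. of_int (phase c) * y ^ card c)"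
    by (simp add: sum_distrib_left mult_ac)
  finally show ?thesis .
qed

text \<open>
  Counting by summing \<open>(-1)^|c \<inter> s|\<close> over all codewords \<open>c\<close> and words \<open>s\<close>: summing over \<open>c\<close> first
  leaves only \<open>s \<in> C\<close> by self-duality, summing over \<open>s\<close> first leaves only the empty \<open>c\<close>.
\<close>

lemma card_C_square: "card C * card C = 2 ^ card I"
proof -
  have "int (card C) * int (card C) = (\<Sum>s\<in>Pow I. \<Sum>c\<in>C. (-1) ^ card (c \<inter> s))"
  proof -
    have "(\<Sum>c\<in>C. (-1 :: int) ^ card (c \<inter> s)) = (if s \<in> C then int (card C) else 0)"
      if "s \<in> Pow I" for s
    proof -
      have fin: "finite s" using that finite_I finite_subset by blast
      have "(\<forall>c\<in>C. (-1 :: int) ^ card (c \<inter> s) = 1) \<longleftrightarrow> s \<in> C"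
        using that by (subst mem_iff) (auto simp: minus_one_power_iff Int_commute split: if_splits)
      then show ?thesis
        using fin by (subst character_sum) (auto simp: sign_sym_diff)
    qed
    moreover have "(\<Sum>s\<in>Pow I. if s \<in> C then int (card C) else 0) = (\<Sum>s\<in>C. int (card C))"
      using finite_I subset_I by (intro sum.mono_neutral_cong_right) auto
    ultimately show ?thesis by simp
  qed
  also have "\<dots> = (\<Sum>c\<in>C. \<Sum>s\<in>Pow I. (-1) ^ card (c \<inter> s))"
    by (rule sum.swap)
  also have "\<dots> = (\<Sum>c\<in>C. if c = {} then 2 ^ card I else 0)"
  proof (rule sum.cong[OF refl])
    fix c assume c: "c \<in> C"
    show "(\<Sum>s\<in>Pow I. (-1) ^ card (c \<inter> s)) = (if c = {} then 2 ^ card I else 0 :: int)"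
      \<comment> \<open>at \<open>y = 0\<close> the weight of each \<open>s\<close> is 1\<close>
      using signed_power_sum_Pow[OF finite_I subset_I[OF c], of "0 :: int"] finite_mem[OF c]
      by (auto simp: power_0_left)
  qed
  also have "\<dots> = 2 ^ card I"
    using finite_C empty_mem by simp
  finally show ?thesis
    by (metis of_nat_eq_iff of_nat_mult of_nat_power of_nat_numeral)
qed

lemma card_C: "card C = 2 ^ (card I div 2)"
proof -
  have "card I = card I div 2 + card I div 2" using even_card[OF I_mem] by auto
  then have "(2 :: nat) ^ card I = (2 ^ (card I div 2))\<^sup>2"
    by (metis power_add power2_eq_square)
  then show ?thesis
    using card_C_square by (metis power2_eq_square power2_eq_iff_nonneg zero_le)
qed

lemma shadow_transform:
  fixes y :: "'a :: {idom, ring_char_0}"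
  shows "(\<Sum>s\<in>shadow. (1 - y) ^ card s * (1 + y) ^ (card I - card s))
       = of_nat (card C) * (\<Sum>c\<in>C. of_int (phase c) * y ^ card c)"
proof -
  have "(2 :: 'a) ^ card I = of_nat (card C) * of_nat (card C)"
    by (metis card_C_square of_nat_mult of_nat_numeral of_nat_power)
  moreover have "(of_nat (card C) :: 'a) \<noteq> 0" by (simp add: card_C)
  ultimately show ?thesis
    using shadow_transform_scaled[of y] by (simp add: mult.assoc)
qed

lemma card_shadow: "card shadow = card C"
proof -
  have "(\<Sum>c\<in>C. phase c * 0 ^ card c) = (\<Sum>c\<in>C. if c = {} then 1 else 0)"
    using finite_mem by (intro sum.cong) (auto simp: power_0_left phase_def)
  also have "\<dots> = 1" using finite_C empty_mem by simp
  finally show ?thesis using shadow_transform[of "0 :: int"] by simp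
qed

text \<open>
  The Gauss sum argument. Evaluated at the imaginary unit, the transform is a sum of \<open>|C|\<close> powers of
  \<open>\<i>\<close> (up to a common factor) with total \<open>|C|\<close>, so each of them equals 1.
\<close>

lemma card_shadow_mem_cong:
  assumes "s \<in> shadow"
  shows "card s mod 4 = (card I div 2) mod 4"
proof -
  define m where "m = card I div 2"
  have I2: "card I = 2 * m" using even_card[OF I_mem] by (auto simp: m_def)
  have c2: "(of_nat (card C) :: complex) = 2 ^ m" by (simp add: card_C m_def)
  have "(1 - \<i>) ^ card s * (1 + \<i>) ^ (card I - card s) = 2 ^ m * \<i> ^ (m + 3 * card s)"
    if "s \<in> shadow" for s
  proof -
    have le: "card s \<le> card I" using that finite_I card_mono by (auto simp: shadow_def)
    \<comment> \<open>writing \<open>1 - \<i>\<close> as a multiple of \<open>1 + \<i>\<close> isolates the dependence on \<open>s\<close> in a power of \<open>\<i>\<close>\<close>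
    have "(1 - \<i>) = \<i> ^ 3 * (1 + \<i>)" by (simp add: power3_eq_cube algebra_simps)
    then have "(1 - \<i>) ^ card s * (1 + \<i>) ^ (card I - card s)
        = \<i> ^ (3 * card s) * ((1 + \<i>) ^ card s * (1 + \<i>) ^ (card I - card s))"
      by (simp add: power_mult_distrib power_mult)
    also have "(1 + \<i>) ^ card s * (1 + \<i>) ^ (card I - card s) = (1 + \<i>) ^ (2 * m)"
      using le I2 by (simp flip: power_add)
    also have "\<dots> = ((1 + \<i>)\<^sup>2) ^ m" by (rule power_mult)
    also have "(1 + \<i>)\<^sup>2 = 2 * \<i>" by (simp add: power2_eq_square algebra_simps)
    finally show ?thesis by (simp add: power_add power_mult_distrib)
  qed
  then have "(\<Sum>s\<in>shadow. 2 ^ m * \<i> ^ (m + 3 * card s))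
      = of_nat (card C) * (\<Sum>c\<in>C. of_int (phase c) * \<i> ^ card c)"
    by (subst shadow_transform[symmetric]) simp
  also have "(\<Sum>c\<in>C. of_int (phase c) * \<i> ^ card c) = (\<Sum>c\<in>C. 1)"
  proof (rule sum.cong[OF refl])
    fix c assume "c \<in> C"
    then have "\<i> ^ card c = of_int (phase c)"
      using even_card[of c] by (auto simp: phase_def power_mult elim!: evenE)
    then show "of_int (phase c) * \<i> ^ card c = 1"
      by (metis of_int_1 of_int_mult phase_square)
  qed
  finally have "2 ^ m * (\<Sum>s\<in>shadow. \<i> ^ (m + 3 * card s)) = 2 ^ m * of_nat (card shadow)"
    by (simp add: sum_distrib_left card_shadow c2)
  then have "(\<Sum>s\<in>shadow. \<i> ^ (m + 3 * card s)) = of_nat (card shadow)" by simp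
  then have "Re (\<Sum>s\<in>shadow. \<i> ^ (m + 3 * card s)) = real (card shadow)" by simp
  then have eq: "(\<Sum>s\<in>shadow. Re (\<i> ^ (m + 3 * card s))) = (\<Sum>s\<in>shadow. 1)"
    by (simp add: Re_sum)
  have le1: "Re (\<i> ^ k) \<le> 1" for k
    using complex_Re_le_cmod[of "\<i> ^ k"] by (simp add: norm_power)
  have "Re (\<i> ^ (m + 3 * card s)) = 1"
    by (rule sum_mono_inv[OF eq _ assms finite_shadow]) (rule le1)
  moreover have "k mod 4 = 0" if "Re (\<i> ^ k) = 1" for k
  proof -
    have "\<i> ^ k = \<i> ^ (4 * (k div 4) + k mod 4)" by simp
    also have "\<dots> = \<i> ^ (k mod 4)" by (simp only: power_add power_mult) simp
    finally have "Re (\<i> ^ (k mod 4)) = 1" using that by simp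
    moreover have "k mod 4 \<in> {0, 1, 2, 3}" by auto
    ultimately show ?thesis by (auto simp: power3_eq_cube)
  qed
  ultimately have "(m + 3 * card s) mod 4 = 0" by blast
  then have "(m + 3 * card s + card s) mod 4 = card s mod 4"
    by (metis add_0 mod_add_left_eq)
  moreover have "m + 3 * card s + card s = m + 4 * card s" by simp
  ultimately show ?thesis by (simp add: m_def)
qed

lemma complement_shadow:
  assumes "s \<in> shadow"
  shows "I - s \<in> shadow"
proof -
  have "(-1 :: int) ^ card (c \<inter> (I - s)) = (-1) ^ card (c \<inter> s)" if "c \<in> C" for c
  proof -
    have "c \<inter> (I - s) = c - (c \<inter> s)" using subset_I[OF that] by auto
    then have "card (c \<inter> (I - s)) + card (c \<inter> s) = card c"
      using finite_mem[OF that] by (simp add: card_Diff_subset card_mono)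
    then show ?thesis
      using even_card[OF that] by (metis even_add minus_one_power_iff)
  qed
  then show ?thesis using assms by (auto simp: shadow_def)
qed

lemma shadow_coeff:
  "(\<Sum>s\<in>shadow. poly.coeff ((1 - [:0, 1:]) ^ card s * (1 + [:0, 1:]) ^ (card I - card s)) k)
     = real (card C) * (\<Sum>c | c \<in> C \<and> card c = k. real_of_int (phase c))"
proof -
  have X: "[:0, 1:] ^ i = (monom 1 i :: real poly)" for i
    by (simp add: monom_altdef)
  have "(\<Sum>s\<in>shadow. (1 - [:0, 1:]) ^ card s * (1 + [:0, 1:]) ^ (card I - card s))
      = (of_nat (card C) * (\<Sum>c\<in>C. of_int (phase c) * [:0, 1:] ^ card c) :: real poly)"
    by (rule shadow_transform)
  then have "(\<Sum>s\<in>shadow. poly.coeff ((1 - [:0, 1:]) ^ card s * (1 + [:0, 1:]) ^ (card I - card s)) k)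
      = poly.coeff (of_nat (card C) * (\<Sum>c\<in>C. of_int (phase c) * [:0, 1:] ^ card c) :: real poly) k"
    by (simp only: coeff_sum [symmetric])
  also have "\<dots> = real (card C) * (\<Sum>c\<in>C. real_of_int (phase c) * (if card c = k then 1 else 0))"
    by (simp add: X of_nat_poly of_int_poly coeff_sum)
  also have "(\<Sum>c\<in>C. real_of_int (phase c) * (if card c = k then 1 else 0))
      = (\<Sum>c | c \<in> C \<and> card c = k. real_of_int (phase c))"
    using finite_C by (intro sum.mono_neutral_cong_right) auto
  finally show ?thesis .
qed

text \<open>
  The coefficients of the transform in degrees 2 and 4 count, up to the factor \<open>|C|\<close> and a sign, the
  codewords of these weights; on the shadow side they are polynomials in \<open>u\<close> of the same degrees.
\<close>

lemma shadow_moments: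
  assumes no2: "\<And>c. c \<in> C \<Longrightarrow> card c \<noteq> 2"
  defines "u \<equiv> \<lambda>s. real (card I) - 2 * real (card s)"
  shows "(\<Sum>s\<in>shadow. (u s)\<^sup>2) = real (card C) * real (card I)"
    and "(\<Sum>s\<in>shadow. u s ^ 4) = real (card C) *
      (24 * real (card {c \<in> C. card c = 4}) + 3 * (real (card I))\<^sup>2 - 2 * real (card I))"
proof -
  define p :: "'i set \<Rightarrow> real poly"
    where "p s = (1 - [:0, 1:]) ^ card s * (1 + [:0, 1:]) ^ (card I - card s)" for s
  let ?n = "real (card I)"
  have le: "card s \<le> card I" if "s \<in> shadow" for s
    using that finite_I card_mono by (auto simp: shadow_def)
  have u: "real (card I - card s) - real (card s) = u s"
    "real (card s) + real (card I - card s) = ?n" if "s \<in> shadow" for s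
    using le[OF that] by (auto simp: u_def of_nat_diff)
  have 2: "2 * poly.coeff (p s) 2 = (u s)\<^sup>2 - ?n" if "s \<in> shadow" for s
    unfolding p_def using krawtchouk_coeffs(1)[of "card s" "card I - card s"] u[OF that] by simp
  have 4: "24 * poly.coeff (p s) 4 = u s ^ 4 - (6 * ?n - 8) * (u s)\<^sup>2 + 3 * ?n\<^sup>2 - 6 * ?n"
    if "s \<in> shadow" for s
    unfolding p_def using krawtchouk_coeffs(2)[of "card s" "card I - card s"] u[OF that] by simp
  have "(\<Sum>s\<in>shadow. 2 * poly.coeff (p s) 2) = 0"
    using shadow_coeff[of 2] no2 unfolding p_def sum_distrib_left[symmetric]
    by (auto intro!: sum.neutral)
  then show m2: "(\<Sum>s\<in>shadow. (u s)\<^sup>2) = real (card C) * ?n"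
    by (simp add: 2 sum_subtractf card_shadow)
  have "(\<Sum>c | c \<in> C \<and> card c = 4. real_of_int (phase c)) = real (card {c \<in> C. card c = 4})"
    by (simp add: phase_def)
  then have "(\<Sum>s\<in>shadow. 24 * poly.coeff (p s) 4)
      = 24 * (real (card C) * real (card {c \<in> C. card c = 4}))"
    using shadow_coeff[of 4] unfolding p_def sum_distrib_left[symmetric] by simp
  then have "(\<Sum>s\<in>shadow. u s ^ 4) - (6 * ?n - 8) * (\<Sum>s\<in>shadow. (u s)\<^sup>2)
      + real (card C) * (3 * ?n\<^sup>2 - 6 * ?n)
      = 24 * (real (card C) * real (card {c \<in> C. card c = 4}))"
    by (simp add: 4 sum.distrib sum_subtractf card_shadow sum_distrib_left algebra_simps)
  then show "(\<Sum>s\<in>shadow. u s ^ 4) = real (card C) *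
      (24 * real (card {c \<in> C. card c = 4}) + 3 * ?n\<^sup>2 - 2 * ?n)"
    unfolding m2 by (simp add: algebra_simps power2_eq_square)
qed

text \<open>
  The multiplier is the number of shadow words of weight \<open>(n - 16)/2\<close>; the condition
  \<open>n = 2 |s| + 16\<close> makes it 0 for \<open>n < 16\<close>.
\<close>

lemma weight_four_count:
  assumes small: "card I < 24"
    and no2: "\<And>c. c \<in> C \<Longrightarrow> card c \<noteq> 2"
  shows "real (card {c \<in> C. card c = 4}) = real (card I) * (22 - real (card I)) / 8
    + real (card {s \<in> shadow. card I = 2 * card s + 16}) * 2 powr ((24 - real (card I)) / 2)"
proof -
  define m where "m = card I div 2"
  have I2: "card I = 2 * m" using even_card[OF I_mem] by (auto simp: m_def)
  define u where "u s = real (card I) - 2 * real (card s)" for s :: "'i set"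
  define L where "L = {s \<in> shadow. card I = 2 * card s + 16}"
  define H where "H = {s \<in> shadow. card I + 16 = 2 * card s}"
  have cardcompl: "card (I - s) = card I - card s" "card s \<le> card I" if "s \<in> shadow" for s
    using that finite_I finite_subset[of s I]
    by (auto simp: shadow_def card_Diff_subset card_mono)
  have "I - s \<in> H" if "s \<in> L" for s
    using that complement_shadow[of s] cardcompl[of s] by (auto simp: L_def H_def)
  moreover have "I - s \<in> L" if "s \<in> H" for s
    using that complement_shadow[of s] cardcompl[of s] by (auto simp: L_def H_def)
  moreover have "I - (I - s) = s" if "s \<in> L \<union> H" for s
    using that shadow_subset[of s] by (auto simp: L_def H_def)
  ultimately have "bij_betw (\<lambda>s. I - s) L H"
    by (intro bij_betw_byWitness[where f' = "\<lambda>s. I - s"]) auto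
  then have LH: "card H = card L" by (simp add: bij_betw_same_card)
  \<comment> \<open>\<open>49152 = 16\<^sup>2 (16\<^sup>2 - 64)\<close>; the factor \<open>u\<^sup>2 - 64\<close> removes the weights at distance 4 from the middle\<close>
  have val: "u s ^ 4 - 64 * (u s)\<^sup>2 = (if s \<in> L \<union> H then 49152 else 0)" if s: "s \<in> shadow" for s
  proof -
    have "card s mod 4 = m mod 4" using card_shadow_mem_cong[OF s] by (simp add: m_def)
    then have "int m mod 4 = int (card s) mod 4" by (metis of_nat_mod of_nat_numeral)
    then have "4 dvd int m - int (card s)" by (simp add: mod_eq_dvd_iff)
    then obtain k where k: "int m - int (card s) = 4 * k" by (elim dvdE)
    have "card s \<le> 2 * m" "m < 12" using cardcompl[OF s] I2 small by auto
    then have "k < 3" "-3 < k" using k by linarith+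
    then have kset: "k \<in> {-2, -1, 0, 1, 2}" by auto
    have "of_int (int m - int (card s)) = (of_int (4 * k) :: real)" by (simp only: k)
    then have "u s = 8 * of_int k" by (simp add: u_def I2)
    moreover have "s \<in> L \<longleftrightarrow> k = 2" "s \<in> H \<longleftrightarrow> k = -2"
      using s k by (auto simp: L_def H_def I2)
    ultimately show ?thesis using kset by auto
  qed
  have "(\<Sum>s\<in>shadow. u s ^ 4 - 64 * (u s)\<^sup>2) = (\<Sum>s\<in>shadow. if s \<in> L \<union> H then 49152 else 0)"
    by (rule sum.cong[OF refl val])
  also have "\<dots> = (\<Sum>s\<in>L \<union> H. 49152)"
    using finite_shadow by (intro sum.mono_neutral_cong_right) (auto simp: L_def H_def)
  also have "\<dots> = 49152 * real (card (L \<union> H))" by simp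
  also have "card (L \<union> H) = card L + card H"
    using finite_shadow by (intro card_Un_disjoint) (auto simp: L_def H_def)
  finally have "(\<Sum>s\<in>shadow. u s ^ 4) - 64 * (\<Sum>s\<in>shadow. (u s)\<^sup>2) = 98304 * real (card L)"
    by (simp add: sum_subtractf sum_distrib_left LH)
  then have key: "2 ^ m * (24 * real (card {c \<in> C. card c = 4}) + 3 * (real (card I))\<^sup>2
      - 66 * real (card I)) = 98304 * real (card L)"
    using shadow_moments[OF no2] unfolding u_def by (simp add: card_C m_def algebra_simps)
  have "m \<le> 12" using I2 small by simp
  then have "(24 - real (card I)) / 2 = real (12 - m)" by (simp add: I2 of_nat_diff)
  then have pw: "2 powr ((24 - real (card I)) / 2) = 2 ^ (12 - m)" by (simp add: powr_realpow)
  have "(2 :: real) ^ m * 2 ^ (12 - m) = 4096" using \<open>m \<le> 12\<close> by (simp flip: power_add)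
  then have "(2 :: real) ^ m * (24 * real (card {c \<in> C. card c = 4}) + 3 * (real (card I))\<^sup>2
      - 66 * real (card I)) = 2 ^ m * (24 * real (card L) * 2 ^ (12 - m))"
    unfolding key by (simp add: mult_ac)
  then have "24 * real (card {c \<in> C. card c = 4}) + 3 * (real (card I))\<^sup>2
      - 66 * real (card I) = 24 * real (card L) * 2 ^ (12 - m)"
    by simp
  then show ?thesis
    unfolding pw L_def by (simp add: field_simps power2_eq_square)
qed

end

section \<open>Supports of binary words\<close>

definition support :: "'a :: zero vec \<Rightarrow> nat set" where
  "support w = {i. i < dim_vec w \<and> w $ i \<noteq> 0}"

lemma hamming_weight_eq_card_support: "hamming_weight w = card (support w)"
  by (simp add: hamming_weight_def support_def)

lemma support_subset: "w \<in> carrier_vec n \<Longrightarrow> support w \<subseteq> {..<n}"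
  by (auto simp: support_def)

lemma bij_betw_support: "bij_betw support (carrier_vec n :: bit vec set) (Pow {..<n})"
  by (rule bij_betw_byWitness[where f' = "\<lambda>A. vec n (\<lambda>i. of_bool (i \<in> A))"])
     (auto simp: support_def)

lemma of_nat_bit: "(of_nat k :: bit) = of_bool (odd k)"
  by (induction k) auto

lemma scalar_prod_eq_0_iff:
  fixes v w :: "bit vec"
  assumes "v \<in> carrier_vec n" "w \<in> carrier_vec n"
  shows "v \<bullet> w = 0 \<longleftrightarrow> even (card (support v \<inter> support w))"
proof -
  have "v \<bullet> w = (\<Sum>i\<in>{0..<n}. of_bool (i \<in> support v \<inter> support w))"
    unfolding scalar_prod_def using assms
    by (intro sum.cong) (auto simp: support_def)
  also have "\<dots> = of_nat (card ({0..<n} \<inter> {i. i \<in> support v \<inter> support w}))"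
    by (simp only: sum_of_bool_eq finite_atLeastLessThan)
  also have "{0..<n} \<inter> {i. i \<in> support v \<inter> support w} = support v \<inter> support w"
    using assms by (auto simp: support_def)
  finally show ?thesis by (simp add: of_nat_bit)
qed

lemma self_dual_family_support:
  assumes "self_dual_code n C"
  shows "self_dual_family {..<n} (support ` C)"
proof
  show "finite {..<n}" by simp
  have ann: "v \<in> C \<longleftrightarrow> v \<in> carrier_vec n \<and> (\<forall>w\<in>C. v \<bullet> w = 0)" for v
    using assms by (auto simp: self_dual_code_def annihilator_def)
  fix A :: "nat set"
  show "A \<in> support ` C \<longleftrightarrow> A \<subseteq> {..<n} \<and> (\<forall>B\<in>support ` C. even (card (A \<inter> B)))"
  proof
    assume "A \<in> support ` C"
    then obtain v where "v \<in> C" "A = support v" by auto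
    then show "A \<subseteq> {..<n} \<and> (\<forall>B\<in>support ` C. even (card (A \<inter> B)))"
      by (metis ann imageE scalar_prod_eq_0_iff support_subset)
  next
    assume A: "A \<subseteq> {..<n} \<and> (\<forall>B\<in>support ` C. even (card (A \<inter> B)))"
    then have "A \<in> support ` (carrier_vec n :: bit vec set)"
      using bij_betw_imp_surj_on[OF bij_betw_support[of n]] by auto
    then obtain v :: "bit vec" where v: "v \<in> carrier_vec n" "A = support v"
      by auto
    have "v \<bullet> w = 0" if "w \<in> C" for w
    proof -
      have "w \<in> carrier_vec n" using that ann by blast
      from scalar_prod_eq_0_iff[OF v(1) this] show ?thesis using A that v(2) by blast
    qed
    then have "v \<in> C" using v(1) ann by blast
    then show "A \<in> support ` C" using v(2) by blast
  qed
qed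

section \<open>The number of codewords of weight four\<close>

theorem mainTheorem6:
  fixes n :: nat and C :: "bit vec set" and d :: real
  assumes "n < 24"
    and "self_dual_code n C"
    and "\<forall>w\<in>C. hamming_weight w \<noteq> 2"
    and "real (card {w \<in> C. hamming_weight w = 4}) = real n * (22 - real n) / 8 + d"
  shows "\<exists>k::nat. d = real k * 2 powr ((24 - real n) / 2)"
proof -
  interpret self_dual_family "{..<n}" "support ` C"
    using assms(2) by (rule self_dual_family_support)
  have "C \<subseteq> carrier_vec n"
    using assms(2) by (auto simp: self_dual_code_def annihilator_def)
  then have "inj_on support C"
    using bij_betw_support[of n] by (meson bij_betw_def inj_on_subset)
  then have "card (support ` {w \<in> C. hamming_weight w = 4}) = card {w \<in> C. hamming_weight w = 4}"
    by (intro card_image) (auto simp: inj_on_def)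
  moreover have "support ` {w \<in> C. hamming_weight w = 4} = {c \<in> support ` C. card c = 4}"
    by (auto simp: hamming_weight_eq_card_support)
  ultimately have "card {c \<in> support ` C. card c = 4} = card {w \<in> C. hamming_weight w = 4}"
    by simp
  moreover have "real (card {c \<in> support ` C. card c = 4}) = real n * (22 - real n) / 8
      + real (card {s \<in> shadow. n = 2 * card s + 16}) * 2 powr ((24 - real n) / 2)"
  proof -
    have "card c \<noteq> 2" if "c \<in> support ` C" for c
      using that assms(3) by (auto simp: hamming_weight_eq_card_support)
    from weight_four_count[OF _ this] show ?thesis using assms(1) by simp
  qed
  ultimately have "d = real (card {s \<in> shadow. n = 2 * card s + 16}) * 2 powr ((24 - real n) / 2)"
    using assms(4) by linarith
  then show ?thesis by blast
qed

end
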